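(* Let $n\ge 2$. For every length function $E$ on $\mathbb C^n$, the space $\mathbb C^n$ is not of $E$-limit type.
   Context: $\Delta$ is the open unit disc in $\mathbb C$, and $\mathrm{Hol}(X,Y)$ is the set of holomorphic maps $X\to Y$. A length function on a complex space $X$ is a real-valued non-negative continuous function $E$ on the tangent bundle $TX$ such that $E(v)=0$ iff $v=0$, and $E(av)=|a|\,E(v)$ for all $a\in\mathbb C$, $v\in TX$. For a holomorphic curve $f:\mathbb C\to X$ put $|f'(z)|_E:=E(f(z),f'(z))$, the $E$-length of the tangent vector $f'(z)$ at $f(z)$. The curve $f$ is an $E$-Brody curve if $|f'|_E$ is bounded on $\mathbb C$. A family $\mathcal F\subset\mathrm{Hol}(X,Y)$ is normal if it is relatively compact in $\mathrm{Hol}(X,Y)$ in the compact-open topology. A sequence $\{f_j\}\subset \mathcal F$ is compactly divergent if for all compact sets $K\subset X$ and $L\subset Y$ there is $j_0$ with $f_j(K)\cap L=\emptyset$ for all $j\ge j_0$. A family $\mathcal F$ is not compactly divergent if it contains no compactly divergent sequence. A complex space $X$ with length function $E$ is of $E$-limit type if: for each family $\mathcal F\subset\mathrm{Hol}(\Delta,X)$ that is not normal and is not compactly divergent, there exist sequences $\{p_j\}\subset\Delta$ with $p_j\to p_0\in\Delta$, $\{f_j\}\subset\mathcal F$, and $\rho_j>0$ with $\rho_j\to0^+$, such that $g_j(\xi):=f_j(p_j+\rho_j\xi)$ converges uniformly on compact subsets of $\mathbb C$ to a non-constant $E$-Brody curve $g:\mathbb C\to X$. (Each $g_j$ is defined where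 $p_j+\rho_j\xi\in\Delta$; any given compact subset of $\mathbb C$ lies in its domain for all large $j$.) *)

theory Defs
  imports "HOL-Analysis.Analysis"
begin

text \<open>
  The target space is \<open>X = \<complex>\<^sup>n\<close>, rendered as \<^typ>\<open>complex ^ 'n\<close>.  Its tangent bundle is
  identified with \<open>\<complex>\<^sup>n \<times> \<complex>\<^sup>n\<close>: the pair \<open>(x, v)\<close> is the tangent vector \<open>v\<close> at the point \<open>x\<close>.
\<close>

abbreviation unit_disc :: "complex set" ("\<Delta>") where
  "\<Delta> \<equiv> ball 0 1"

definition length_function :: "((complex ^ 'n) \<times> (complex ^ 'n) \<Rightarrow> real) \<Rightarrow> bool" where
  "length_function E \<longleftrightarrow>
     continuous_on UNIV E \<and>
     (\<forall>x v. 0 \<le> E (x, v)) \<and>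
     (\<forall>x v. E (x, v) = 0 \<longleftrightarrow> v = 0) \<and>
     (\<forall>a x v. E (x, a *s v) = cmod a * E (x, v))"

text \<open>
  The elements of \<open>Hol S\<close> take the value \<^const>\<open>undefined\<close> outside \<open>S\<close>, so that they correspond
  one-to-one to the holomorphic maps \<open>S \<rightarrow> \<complex>\<^sup>n\<close>.
\<close>

definition Hol :: "complex set \<Rightarrow> (complex \<Rightarrow> complex ^ 'n) set" where
  "Hol S = {f \<in> extensional S. \<forall>i. (\<lambda>z. f z $ i) holomorphic_on S}"

definition curve_deriv :: "(complex \<Rightarrow> complex ^ 'n) \<Rightarrow> complex \<Rightarrow> complex ^ 'n" where
  "curve_deriv f z = (\<chi> i. deriv (\<lambda>w. f w $ i) z)"

definition Brody_curve ::
  "((complex ^ 'n) \<times> (complex ^ 'n) \<Rightarrow> real) \<Rightarrow> (complex \<Rightarrow> complex ^ 'n) \<Rightarrow> bool" where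
  "Brody_curve E f \<longleftrightarrow> f \<in> Hol UNIV \<and> bounded (range (\<lambda>z. E (f z, curve_deriv f z)))"

definition compact_open_topology :: "complex set \<Rightarrow> (complex \<Rightarrow> complex ^ 'n) topology" where
  "compact_open_topology S =
     topology_generated_by {{f \<in> Hol S. f ` K \<subseteq> U} | K U. compact K \<and> K \<subseteq> S \<and> open U}"

lemma topspace_compact_open_topology: "topspace (compact_open_topology S) = Hol S"
proof -
  have "Hol S \<in> {{f \<in> Hol S. f ` K \<subseteq> U} | K U. compact K \<and> K \<subseteq> S \<and> open (U :: (complex ^ 'n) set)}"
    by (intro CollectI exI[of _ "{}"]) auto
  then show ?thesis
    unfolding compact_open_topology_def topology_generated_by_topspace by auto
qed

definition normal_family :: "complex set \<Rightarrow> (complex \<Rightarrow> complex ^ 'n) set \<Rightarrow> bool" where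
  "normal_family S F \<longleftrightarrow>
     compactin (compact_open_topology S) (compact_open_topology S closure_of F)"

definition compactly_divergent :: "complex set \<Rightarrow> (nat \<Rightarrow> complex \<Rightarrow> complex ^ 'n) \<Rightarrow> bool" where
  "compactly_divergent S f \<longleftrightarrow>
     (\<forall>K L. compact K \<and> K \<subseteq> S \<and> compact L \<longrightarrow> (\<exists>j0. \<forall>j\<ge>j0. f j ` K \<inter> L = {}))"

definition not_compactly_divergent_family ::
  "complex set \<Rightarrow> (complex \<Rightarrow> complex ^ 'n) set \<Rightarrow> bool" where
  "not_compactly_divergent_family S F \<longleftrightarrow> \<not> (\<exists>f. range f \<subseteq> F \<and> compactly_divergent S f)"

text \<open>
  In the next definition, the values of \<open>f j\<close> outside \<open>\<Delta>\<close> play no role: a compact set \<open>K\<close> satisfies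
  \<open>p j + \<rho> j * \<xi> \<in> \<Delta>\<close> for all \<open>\<xi> \<in> K\<close> and all large \<open>j\<close>, and \<^const>\<open>uniform_limit\<close> only depends
  on large \<open>j\<close>.
\<close>

definition limit_type :: "((complex ^ 'n) \<times> (complex ^ 'n) \<Rightarrow> real) \<Rightarrow> bool" where
  "limit_type E \<longleftrightarrow>
     (\<forall>F \<subseteq> Hol \<Delta>. \<not> normal_family \<Delta> F \<and> not_compactly_divergent_family \<Delta> F \<longrightarrow>
        (\<exists>p p0 f \<rho> g.
           range p \<subseteq> \<Delta> \<and> p0 \<in> \<Delta> \<and> p \<longlonglongrightarrow> p0 \<and>
           range f \<subseteq> F \<and>
           (\<forall>j::nat. 0 < \<rho> j) \<and> \<rho> \<longlonglongrightarrow> 0 \<and>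
           (\<forall>K. compact K \<longrightarrow>
              uniform_limit K (\<lambda>j \<xi>. f j (p j + complex_of_real (\<rho> j) * \<xi>)) g sequentially) \<and>
           Brody_curve E g \<and> \<not> g constant_on UNIV))"

end

theory Submission
  imports Defs "HOL-Complex_Analysis.Cauchy_Integral_Formula"
begin

text \<open>
  Take an entire curve \<open>c(z) = (h(z), z, 0, \<dots>, 0)\<close> with \<open>h(k) = 0\<close> at the natural numbers \<open>k\<close>
  and \<open>h'(k)\<close> so large that \<open>c\<close> is not \<open>E\<close>-Brody. The maps \<open>z \<mapsto> c(Nz)\<close> all vanish at \<open>0\<close>, so
  no sequence of them is compactly divergent, and they are unbounded at \<open>1/2\<close>, so they do not
  form a normal family. The second coordinate forces every locally
  uniform limit of rescalings of its members to be an affine reparametrization of \<open>c\<close>, and this is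
  either constant or again not \<open>E\<close>-Brody.
\<close>

section \<open>Entire functions that are large at the natural numbers\<close>

text \<open>The function is a constant plus the series of the powers \<open>(z / a m) ^ n m\<close>.
  As \<open>m + 1\<close> exceeds \<open>a m\<close>, a large exponent lifts term \<open>m\<close>
  above \<open>W (Suc m)\<close> at the point \<open>m + 1\<close>. All terms are nonnegative at the
  natural numbers, so nothing cancels there. On a fixed disc \<open>norm z / a m\<close> is
  eventually at most 1/2, and \<open>n m\<close> is at least \<open>m\<close>, so a geometric series
  dominates.\<close>

lemma entire_dominating_sequence:
  fixes W :: "nat \<Rightarrow> real"
  obtains H :: "complex \<Rightarrow> complex"
    where "H holomorphic_on UNIV" "\<And>k. W k \<le> cmod (H (of_nat k))"
proof -
  \<comment> \<open>The shift by 1/2 keeps \<open>a m\<close> below \<open>m + 1\<close> and makes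
    \<open>a 0\<close> nonzero, as the division in \<open>t\<close> requires.\<close>
  define a where "a m = real m + 1/2" for m
  have a_pos: "a m > 0" for m by (simp add: a_def add_nonneg_pos)
  have "\<exists>n\<ge>m. W (Suc m) \<le> (real (Suc m) / a m) ^ n" for m
  proof -
    have q: "1 < real (Suc m) / a m" using a_pos[of m] by (simp add: a_def)
    obtain n where n: "W (Suc m) < (real (Suc m) / a m) ^ n"
      using real_arch_pow[OF q] by blast
    have "(real (Suc m) / a m) ^ n \<le> (real (Suc m) / a m) ^ max m n"
      using q by (intro power_increasing) auto
    with n show ?thesis by (intro exI[of _ "max m n"]) auto
  qed
  then obtain n where n: "\<And>m. m \<le> n m" "\<And>m. W (Suc m) \<le> (real (Suc m) / a m) ^ n m"
    by metis
  define t where "t m z = (z / of_real (a m)) ^ n m" for m and z :: complex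
  have conv: "uniform_limit (cball 0 R) (\<lambda>N z. \<Sum>m<N. t m z) (\<lambda>z. \<Sum>m. t m z) sequentially" for R
  proof (rule Weierstrass_m_test_ev)
    have "\<forall>\<^sub>F m in sequentially. 2 * R \<le> real m"
      using filterlim_real_sequentially by (auto simp: filterlim_at_top)
    then show "\<forall>\<^sub>F m in sequentially. \<forall>z\<in>cball 0 R. norm (t m z) \<le> (1/2) ^ m"
    proof (rule eventually_mono, intro ballI)
      fix m z assume m: "2 * R \<le> real m" and "z \<in> cball (0::complex) R"
      then have "norm z \<le> 1/2 * a m" by (simp add: a_def)
      then have "norm z / a m \<le> 1/2" using a_pos[of m] by (subst pos_divide_le_eq)
      then have "(norm z / a m) ^ n m \<le> (1/2) ^ n m"
        using a_pos[of m] by (intro power_mono) auto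
      then have "norm (t m z) \<le> (1/2) ^ n m"
        using a_pos[of m] by (simp add: t_def norm_power norm_divide)
      also have "\<dots> \<le> (1/2) ^ m" by (rule power_decreasing) (use n in auto)
      finally show "norm (t m z) \<le> (1/2) ^ m" .
    qed
  qed simp
  have sums: "(\<lambda>m. t m z) sums (\<Sum>m. t m z)" for z
    unfolding sums_def by (rule tendsto_uniform_limitI[OF conv[of "norm z"]]) simp
  \<comment> \<open>Term \<open>m\<close> takes care of the point \<open>m + 1\<close>; the point 0
    is left to the constant.\<close>
  define H where "H z = of_real \<bar>W 0\<bar> + (\<Sum>m. t m z)" for z
  have "(\<lambda>z. \<Sum>m. t m z) holomorphic_on UNIV"
  proof (rule holomorphic_uniform_sequence)
    show "(\<lambda>z. \<Sum>m<N. t m z) holomorphic_on UNIV" for N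
      unfolding t_def using a_pos by (intro holomorphic_intros) (simp add: less_imp_neq[symmetric])
    fix x :: complex
    have "cball x 1 \<subseteq> cball 0 (norm x + 1)"
      by (simp add: cball_subset_cball_iff)
    then show "\<exists>d>0. cball x d \<subseteq> UNIV \<and>
        uniform_limit (cball x d) (\<lambda>N z. \<Sum>m<N. t m z) (\<lambda>z. \<Sum>m. t m z) sequentially"
      using uniform_limit_on_subset[OF conv] by (intro exI[of _ 1]) auto
  qed simp
  then have "H holomorphic_on UNIV" unfolding H_def by (intro holomorphic_intros)
  moreover have "W k \<le> cmod (H (of_nat k))" for k
  proof -
    define r where "r m = (real k / a m) ^ n m" for m
    have r0: "0 \<le> r m" for m unfolding r_def using a_pos[of m] by simp
    have "(\<lambda>m. Re (t m (of_nat k))) sums Re (\<Sum>m. t m (of_nat k))"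
      by (rule sums_Re[OF sums])
    moreover have "t m (of_nat k) = of_real (r m)" for m
      by (simp add: t_def r_def)
    ultimately have r: "r sums Re (\<Sum>m. t m (of_nat k))" by simp
    have "W k \<le> \<bar>W 0\<bar> + suminf r"
    proof (cases k)
      case 0
      then show ?thesis using suminf_nonneg[OF sums_summable[OF r]] r0 by simp
    next
      case (Suc m)
      then have "W k \<le> r m" using n(2)[of m] by (simp add: r_def)
      also have "\<dots> \<le> suminf r"
        using sum_le_suminf[OF sums_summable[OF r], of "{m}"] r0 by simp
      finally show ?thesis by simp
    qed
    also have "\<dots> = Re (H (of_nat k))" using r by (simp add: H_def sums_iff)
    also have "\<dots> \<le> cmod (H (of_nat k))" by (rule complex_Re_le_cmod)
    finally show ?thesis .
  qed
  ultimately show ?thesis using that by blast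
qed

section \<open>Normality and pointwise boundedness\<close>

text \<open>Bounding the value at \<open>z\<close> by \<open>r\<close> is a subbasic open condition,
  given by the compact set \<open>{z}\<close>. These conditions cover the compact closure of
  \<open>F\<close>, so finitely many radii suffice.\<close>

lemma normal_family_bounded_at:
  fixes F :: "(complex \<Rightarrow> complex ^ 'n) set"
  assumes "normal_family S F" "F \<subseteq> Hol S" "z \<in> S"
  shows "bounded ((\<lambda>f. f z) ` F)"
proof -
  let ?T = "compact_open_topology S :: (complex \<Rightarrow> complex ^ 'n) topology"
  define U where "U r = {f \<in> Hol S. f ` {z} \<subseteq> ball (0 :: complex ^ 'n) (real r)}" for r :: nat
  have F: "F \<subseteq> ?T closure_of F"
    using assms(2) by (simp add: closure_of_subset topspace_compact_open_topology)
  have "openin ?T (U r)" for r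
    unfolding compact_open_topology_def U_def openin_topology_generated_by_iff
    using assms(3)
    by (intro generate_topology_on.Basis CollectI exI[of _ "{z}"] exI[of _ "ball 0 (real r)"]) auto
  moreover have "?T closure_of F \<subseteq> \<Union> (range U)"
  proof
    fix f assume "f \<in> ?T closure_of F"
    then have "f \<in> Hol S"
      using closure_of_subset_topspace[of ?T F] by (auto simp: topspace_compact_open_topology)
    moreover obtain r :: nat where "norm (f z) < real r" using reals_Archimedean2 by blast
    ultimately show "f \<in> \<Union> (range U)" by (auto simp: U_def)
  qed
  ultimately obtain \<F> where \<F>: "finite \<F>" "\<F> \<subseteq> range U" "?T closure_of F \<subseteq> \<Union> \<F>"
    using compactinD[OF assms(1)[unfolded normal_family_def], of "range U"] by blast
  from finite_subset_image[OF \<F>(1,2)] obtain I where I: "finite I" "\<F> = U ` I" by blast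
  have "(\<lambda>f. f z) ` F \<subseteq> (\<Union>r\<in>I. ball 0 (real r))"
  proof clarify
    fix f assume "f \<in> F"
    then have "f \<in> (\<Union>r\<in>I. U r)" using F \<F>(3) I(2) by blast
    then show "f z \<in> (\<Union>r\<in>I. ball 0 (real r))" by (auto simp: U_def)
  qed
  moreover have "bounded (\<Union>r\<in>I. ball (0 :: complex ^ 'n) (real r))"
    using I by (intro bounded_UN) auto
  ultimately show ?thesis using bounded_subset by blast
qed

section \<open>Growth of a length function along an affine line\<close>

text \<open>By homogeneity \<open>E (x, w *s u + v)\<close> is \<open>cmod w\<close> times
  \<open>E (x, u + (1/w) *s v)\<close>, and by continuity the second factor stays above half of the
  positive number \<open>E (x, u)\<close> for large \<open>w\<close>.\<close>

lemma length_function_large_on_affine_line: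
  fixes E :: "(complex ^ 'n) \<times> (complex ^ 'n) \<Rightarrow> real"
  assumes "length_function E" "u \<noteq> 0"
  obtains W where "\<And>w. W \<le> cmod w \<Longrightarrow> B \<le> E (x, w *s u + v)"
proof -
  have cont: "continuous_on UNIV E" and pos: "0 < E (x, u)"
    and hom: "\<And>a x v. E (x, a *s v) = cmod a * E (x, v)"
    using assms by (auto simp: length_function_def order.strict_iff_order)
  have "continuous_on UNIV (\<lambda>s. E (x, u + s *s v))"
    unfolding vector_scalar_mult_def
    by (intro continuous_on_compose2[OF cont] continuous_intros) auto
  then have "((\<lambda>s. E (x, u + s *s v)) \<longlongrightarrow> E (x, u)) (at 0)"
    by (auto simp: continuous_on_eq_continuous_at isCont_def dest: spec[of _ 0])
  then have "\<forall>\<^sub>F s in at 0. E (x, u) / 2 < E (x, u + s *s v)"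
    by (rule order_tendstoD) (use pos in simp)
  then obtain d where d: "d > 0"
      "\<And>s. s \<noteq> 0 \<Longrightarrow> cmod s < d \<Longrightarrow> E (x, u) / 2 < E (x, u + s *s v)"
    by (auto simp: eventually_at)
  show ?thesis
  proof (rule that)
    \<comment> \<open>The first entry gives \<open>w\<close> nonzero and
      \<open>cmod (1/w) < d\<close>, the added 1 making this strict; the second gives
      \<open>B \<le> cmod w * E (x, u) / 2\<close>.\<close>
    fix w assume w: "max (1/d + 1) (2 * \<bar>B\<bar> / E (x, u)) \<le> cmod w"
    have dw: "1/d < cmod w" using w by simp
    moreover have "0 < 1/d" using d(1) by simp
    ultimately have "0 < cmod w" by linarith
    then have "cmod (1/w) < d"
      using dw d(1) by (simp add: norm_divide divide_less_eq mult.commute)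
    with \<open>0 < cmod w\<close> have "w \<noteq> 0" "E (x, u) / 2 < E (x, u + (1/w) *s v)"
      using d(2)[of "1/w"] by auto
    have "2 * \<bar>B\<bar> \<le> cmod w * E (x, u)" using w pos by (simp add: divide_le_eq)
    then have "B \<le> cmod w * (E (x, u) / 2)" by simp
    also have "\<dots> \<le> cmod w * E (x, u + (1/w) *s v)"
      using \<open>E (x, u) / 2 < _\<close> by (intro mult_left_mono) auto
    also have "\<dots> = E (x, w *s (u + (1/w) *s v))" by (rule hom[symmetric])
    also have "w *s (u + (1/w) *s v) = w *s u + v"
      using \<open>w \<noteq> 0\<close> by (simp add: vec_eq_iff field_simps)
    finally show "B \<le> E (x, w *s u + v)" .
  qed
qed

section \<open>Graph curves that are not Brody\<close>

text \<open>For distinct \<open>a\<close> and \<open>b\<close> this is the graph of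
  \<open>h\<close>, with the parameter readable from coordinate \<open>b\<close>.\<close>

definition graph_curve :: "'n \<Rightarrow> 'n \<Rightarrow> (complex \<Rightarrow> complex) \<Rightarrow> complex \<Rightarrow> complex ^ 'n" where
  "graph_curve a b h z = h z *s axis a 1 + z *s axis b 1"

lemma graph_curve_nth:
  "graph_curve a b h z $ i = h z * (if i = a then 1 else 0) + z * (if i = b then 1 else 0)"
  by (simp add: graph_curve_def axis_def)

lemma graph_curve_holomorphic:
  assumes "h holomorphic_on UNIV"
  shows "(\<lambda>z. graph_curve a b h (\<alpha> + \<beta> * z) $ i) holomorphic_on S"
proof -
  have "(h \<circ> (\<lambda>z. \<alpha> + \<beta> * z)) holomorphic_on S"
    by (rule holomorphic_on_compose_gen[OF _ assms]) (auto intro!: holomorphic_intros)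
  then show ?thesis
    unfolding graph_curve_nth o_def by (intro holomorphic_intros) auto
qed

text \<open>The factor \<open>\<beta>\<close> is kept outside so that homogeneity of
  \<open>E\<close> applies; the rest is a point of the affine line with direction
  \<open>axis a 1\<close>.\<close>

lemma curve_deriv_graph_curve:
  assumes "h holomorphic_on UNIV"
  shows "curve_deriv (\<lambda>z. graph_curve a b h (\<alpha> + \<beta> * z)) z
    = \<beta> *s (deriv h (\<alpha> + \<beta> * z) *s axis a 1 + axis b 1)"
proof -
  have h: "(h has_field_derivative deriv h (\<alpha> + \<beta> * z)) (at (\<alpha> + \<beta> * z))"
    using assms holomorphic_derivI by blast
  have h': "((\<lambda>w. h (\<alpha> + \<beta> * w)) has_field_derivative deriv h (\<alpha> + \<beta> * z) * \<beta>) (at z)"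
    by (rule DERIV_chain'[where f = "\<lambda>w. \<alpha> + \<beta> * w" and g = h, OF _ h])
      (auto intro!: derivative_eq_intros)
  have "((\<lambda>w. graph_curve a b h (\<alpha> + \<beta> * w) $ i) has_field_derivative
      deriv h (\<alpha> + \<beta> * z) * \<beta> * (if i = a then 1 else 0) + \<beta> * (if i = b then 1 else 0)) (at z)" for i
    unfolding graph_curve_nth by (rule derivative_eq_intros h' refl | simp)+
  from DERIV_imp_deriv[OF this] show ?thesis
    by (simp add: curve_deriv_def vec_eq_iff axis_def algebra_simps)
qed

text \<open>With \<open>h z = sin (pi * z) * H z\<close>, the curve vanishes in coordinate
  \<open>a\<close> at the natural numbers, while the derivative of \<open>h\<close> at
  \<open>k\<close> is \<open>H k\<close> up to sign and the factor \<open>pi\<close>. A fast growing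
  \<open>H\<close> then makes the \<open>E\<close>-length at \<open>k\<close> at least
  \<open>k\<close>.\<close>

lemma exists_non_Brody_graph_curve:
  fixes E :: "(complex ^ 'n) \<times> (complex ^ 'n) \<Rightarrow> real"
  assumes "length_function E"
  obtains h where "h holomorphic_on UNIV" "h 0 = 0"
    "\<And>\<alpha> \<beta>. \<beta> \<noteq> 0 \<Longrightarrow> \<not> Brody_curve E (\<lambda>z. graph_curve a b h (\<alpha> + \<beta> * z))"
proof -
  \<comment> \<open>Where \<open>h\<close> vanishes, the point of the curve does not depend on
    \<open>h\<close>, so these thresholds can be fixed before \<open>h\<close> is
    constructed.\<close>
  have "\<exists>W. \<forall>w. W \<le> cmod w \<longrightarrow> real k \<le> E (of_nat k *s axis b 1, w *s axis a 1 + axis b 1)" for k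
  proof -
    have "axis a 1 \<noteq> (0 :: complex ^ 'n)" by simp
    from length_function_large_on_affine_line[OF assms this] show ?thesis by metis
  qed
  then obtain W where W: "\<And>k w. W k \<le> cmod w \<Longrightarrow>
      real k \<le> E (of_nat k *s axis b 1, w *s axis a 1 + axis b 1)" by metis
  obtain H where H: "H holomorphic_on UNIV" "\<And>k. \<bar>W k\<bar> \<le> cmod (H (of_nat k))"
    using entire_dominating_sequence[of "\<lambda>k. \<bar>W k\<bar>"] by metis
  define h where "h z = sin (of_real pi * z) * H z" for z
  have hol: "h holomorphic_on UNIV"
    unfolding h_def using H(1) by (intro holomorphic_intros) auto
  have h_nat: "h (of_nat k) = 0" for k
    unfolding h_def using sin_npi2[of k]
    by (metis mult_zero_left of_real_0 of_real_mult of_real_of_nat_eq sin_of_real)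
  have h'_nat: "\<bar>W k\<bar> \<le> cmod (deriv h (of_nat k))" for k
  proof -
    have s: "sin (of_real pi * of_nat k :: complex) = 0"
      using sin_npi2[of k] by (metis of_real_0 of_real_mult of_real_of_nat_eq sin_of_real)
    have c: "cos (of_real pi * of_nat k :: complex) = (-1) ^ k"
      using cos_npi2[of k]
      by (metis cos_of_real of_real_1 of_real_minus of_real_mult of_real_of_nat_eq of_real_power)
    have "(h has_field_derivative of_real pi * cos (of_real pi * of_nat k) * H (of_nat k)
        + sin (of_real pi * of_nat k) * deriv H (of_nat k)) (at (of_nat k))"
      unfolding h_def
      by (rule derivative_eq_intros holomorphic_derivI[OF H(1)] refl | simp)+
    then have "deriv h (of_nat k) = of_real pi * (-1) ^ k * H (of_nat k)"
      using s c by (simp add: DERIV_imp_deriv)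
    then have "cmod (deriv h (of_nat k)) = pi * cmod (H (of_nat k))"
      by (simp add: norm_mult norm_power)
    also have "\<dots> \<ge> 1 * cmod (H (of_nat k))"
      using pi_gt3 by (intro mult_right_mono) auto
    finally show ?thesis using H(2)[of k] by simp
  qed
  have "\<not> Brody_curve E (\<lambda>z. graph_curve a b h (\<alpha> + \<beta> * z))" if "\<beta> \<noteq> 0" for \<alpha> \<beta>
  proof
    let ?g = "\<lambda>z. graph_curve a b h (\<alpha> + \<beta> * z)"
    assume "Brody_curve E ?g"
    then obtain B where B: "\<And>z. E (?g z, curve_deriv ?g z) \<le> B"
      unfolding Brody_curve_def bounded_iff by (auto dest: abs_le_D1)
    obtain k :: nat where k: "B / cmod \<beta> < real k" using reals_Archimedean2 by blast
    define z where "z = (of_nat k - \<alpha>) / \<beta>"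
    have z: "\<alpha> + \<beta> * z = of_nat k" using that by (simp add: z_def)
    have "W k \<le> cmod (deriv h (of_nat k))" using h'_nat[of k] by linarith
    then have "real k \<le> E (of_nat k *s axis b 1, deriv h (of_nat k) *s axis a 1 + axis b 1)"
      by (rule W)
    \<comment> \<open>Reparametrization scales the length at the preimage of \<open>k\<close> only
      by the fixed factor \<open>cmod \<beta>\<close>, so it remains unbounded in
      \<open>k\<close>.\<close>
    then have "cmod \<beta> * real k \<le> E (?g z, curve_deriv ?g z)"
      using assms unfolding curve_deriv_graph_curve[OF hol] z
      by (simp add: graph_curve_def h_nat length_function_def mult_left_mono
          del: vector_add_ldistrib vector_smult_assoc)
    with B[of z] k that show False by (simp add: field_simps)
  qed
  then show ?thesis using that hol h_nat[of 0] by simp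
qed

section \<open>Limits of rescaled graph curves\<close>

text \<open>Coordinate \<open>b\<close> of the rescaled curve is \<open>c j + d j * \<xi>\<close>
  itself. Convergence at 0 and 1 therefore forces \<open>c\<close> and \<open>d\<close> to converge,
  and continuity of \<open>h\<close> identifies the limit curve.\<close>

lemma rescaled_graph_curve_limit:
  assumes h: "continuous_on UNIV h" and "a \<noteq> b"
    and lim: "\<And>\<xi>. (\<lambda>j. graph_curve a b h (c j + d j * \<xi>)) \<longlonglongrightarrow> g \<xi>"
  obtains \<alpha> \<beta> where "g = (\<lambda>\<xi>. graph_curve a b h (\<alpha> + \<beta> * \<xi>))"
proof -
  have b: "graph_curve a b h z $ b = z" for z using assms(2) by (simp add: graph_curve_nth)
  have lin: "(\<lambda>j. c j + d j * \<xi>) \<longlonglongrightarrow> g \<xi> $ b" for \<xi>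
    using tendsto_vec_nth[OF lim[of \<xi>], of b] by (simp add: b)
  define \<alpha> \<beta> where "\<alpha> = g 0 $ b" and "\<beta> = g 1 $ b - g 0 $ b"
  have "c \<longlonglongrightarrow> \<alpha>" using lin[of 0] by (simp add: \<alpha>_def)
  moreover have "d \<longlonglongrightarrow> \<beta>" using tendsto_diff[OF lin[of 1] lin[of 0]] by (simp add: \<beta>_def)
  ultimately have aff: "(\<lambda>j. c j + d j * \<xi>) \<longlonglongrightarrow> \<alpha> + \<beta> * \<xi>" for \<xi>
    by (intro tendsto_intros)
  have "continuous_on UNIV (graph_curve a b h)"
    unfolding graph_curve_def vector_scalar_mult_def using h by (intro continuous_intros) auto
  then have "(\<lambda>j. graph_curve a b h (c j + d j * \<xi>)) \<longlonglongrightarrow> graph_curve a b h (\<alpha> + \<beta> * \<xi>)" for \<xi>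
    by (rule continuous_on_tendsto_compose[OF _ aff]) auto
  then have "g \<xi> = graph_curve a b h (\<alpha> + \<beta> * \<xi>)" for \<xi>
    using LIMSEQ_unique[OF lim] by blast
  then show ?thesis using that by blast
qed

section \<open>The family of dilations of a graph curve\<close>

theorem theorem1p6:
  fixes E :: "(complex ^ 'n) \<times> (complex ^ 'n) \<Rightarrow> real"
  assumes "CARD('n) \<ge> 2" and "length_function E"
  shows "\<not> limit_type E"
proof
  assume lt: "limit_type E"
  obtain a b :: 'n where ab: "a \<noteq> b"
    using assms(1) card_le_Suc0_iff_eq[of "UNIV :: 'n set"] by auto
  obtain h where hol: "h holomorphic_on UNIV" and h0: "h 0 = 0"
    and nb: "\<And>\<alpha> \<beta>. \<beta> \<noteq> 0 \<Longrightarrow> \<not> Brody_curve E (\<lambda>z. graph_curve a b h (\<alpha> + \<beta> * z))"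
    using exists_non_Brody_graph_curve[OF assms(2), of a b] by blast
  define f where "f N = restrict (\<lambda>z. graph_curve a b h (of_nat N * z)) \<Delta>" for N :: nat
  have fz: "f N z = graph_curve a b h (of_nat N * z)" if "z \<in> \<Delta>" for N z
    using that by (simp add: f_def)
  have f_Hol: "range f \<subseteq> Hol \<Delta>"
  proof clarify
    fix N
    have "(\<lambda>z. f N z $ i) holomorphic_on \<Delta>" for i
      using graph_curve_holomorphic[OF hol, of a b 0 "of_nat N" i \<Delta>]
      by (rule holomorphic_transform) (simp add: fz)
    then show "f N \<in> Hol \<Delta>" by (simp add: Hol_def f_def)
  qed
  have "\<not> normal_family \<Delta> (range f)"
  proof
    assume "normal_family \<Delta> (range f)"
    then have "bounded ((\<lambda>u. u (1/2)) ` range f)"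
      using f_Hol by (rule normal_family_bounded_at) simp
    then obtain B where B: "\<And>N. norm (f N (1/2)) \<le> B" by (auto simp: bounded_iff)
    obtain N :: nat where "2 * B < real N" using reals_Archimedean2 by blast
    \<comment> \<open>Coordinate \<open>b\<close> alone shows unboundedness, whatever
      \<open>h\<close> does.\<close>
    moreover have "norm (f N (1/2) $ b) = real N / 2"
      using ab by (simp add: fz graph_curve_nth norm_divide)
    ultimately show False
      using B[of N] Finite_Cartesian_Product.norm_nth_le[of "f N (1/2)" b] by linarith
  qed
  moreover have "not_compactly_divergent_family \<Delta> (range f)"
    unfolding not_compactly_divergent_family_def
  proof clarify
    fix u assume u: "range u \<subseteq> range f" "compactly_divergent \<Delta> u"
    have "u j 0 = 0" for j
    proof -
      obtain N where "u j = f N" using u(1) by blast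
      then show ?thesis by (simp add: fz graph_curve_def h0)
    qed
    \<comment> \<open>Taking \<open>{0}\<close> both as \<open>K\<close> and as \<open>L\<close>
      contradicts that every member fixes the origin.\<close>
    moreover have "\<exists>j0. \<forall>j\<ge>j0. u j ` {0} \<inter> {0} = {}"
      by (rule u(2)[unfolded compactly_divergent_def, rule_format]) simp
    ultimately show False by auto
  qed
  ultimately obtain p p0 u \<rho> g where
    p0: "p0 \<in> \<Delta>" "p \<longlonglongrightarrow> p0" and u: "range u \<subseteq> range f" and \<rho>: "\<rho> \<longlonglongrightarrow> (0::real)"
    and lim: "\<And>K. compact K \<Longrightarrow>
      uniform_limit K (\<lambda>j \<xi>. u j (p j + complex_of_real (\<rho> j) * \<xi>)) g sequentially"
    and g: "Brody_curve E g" "\<not> g constant_on UNIV"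
    using lt f_Hol unfolding limit_type_def by (smt (verit, best))
  have "\<forall>j. \<exists>N. u j = f N" using u by blast
  then obtain N where N: "\<And>j. u j = f (N j)" by metis
  \<comment> \<open>The dilation factor \<open>N j\<close> is absorbed into the affine coefficients,
    so \<open>\<rho> j\<close> tending to 0 does not prevent a nonzero limit of the slopes.\<close>
  have "(\<lambda>j. graph_curve a b h (of_nat (N j) * p j + (of_nat (N j) * of_real (\<rho> j)) * \<xi>)) \<longlonglongrightarrow> g \<xi>" for \<xi>
  proof (rule Lim_transform_eventually)
    show "(\<lambda>j. u j (p j + complex_of_real (\<rho> j) * \<xi>)) \<longlonglongrightarrow> g \<xi>"
      using lim[of "{\<xi>}"] by (rule tendsto_uniform_limitI) auto
    have "(\<lambda>j. p j + complex_of_real (\<rho> j) * \<xi>) \<longlonglongrightarrow> p0 + of_real 0 * \<xi>"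
      by (intro tendsto_intros p0 \<rho>)
    \<comment> \<open>Since \<open>p0\<close> lies in the open disc, the arguments are eventually in
      the disc, where \<open>f\<close> agrees with the dilated curve instead of being
      \<open>undefined\<close>.\<close>
    then have "\<forall>\<^sub>F j in sequentially. p j + complex_of_real (\<rho> j) * \<xi> \<in> \<Delta>"
      by (rule topological_tendstoD) (use p0 in auto)
    then show "\<forall>\<^sub>F j in sequentially. u j (p j + complex_of_real (\<rho> j) * \<xi>)
        = graph_curve a b h (of_nat (N j) * p j + (of_nat (N j) * of_real (\<rho> j)) * \<xi>)"
      by eventually_elim (simp add: N fz algebra_simps)
  qed
  then obtain \<alpha> \<beta> where g_eq: "g = (\<lambda>\<xi>. graph_curve a b h (\<alpha> + \<beta> * \<xi>))"
    using rescaled_graph_curve_limit[OF holomorphic_on_imp_continuous_on[OF hol] ab] by metis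
  show False
  proof (cases "\<beta> = 0")
    case True
    then show False using g(2) by (auto simp: g_eq constant_on_def)
  next
    case False
    then show False using nb g(1) by (simp add: g_eq)
  qed
qed

end
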